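(* Let $n\ge 2$ and let $Z\subset \mathbb{A}^{n}$ be an algebraic set of the form $Z = F \times W \subset \mathbb{A}^{2} \times \mathbb{A}^{n-2}=\mathbb{A}^n$, where $F\subset \mathbb{A}^{2}$ is a finite set of $l$ points, and $W\subset \mathbb{A}^{n-2}$ is the common zero set of $m$ polynomials $q_1,\ldots,q_m$ in $n-2$ variables, each of degree at most $d$. Then there exists a surjective morphism $f: \mathbb{A}^{n} \to \mathbb{A}^{n} \setminus Z$ of degree $$\deg(f) \leq \max(1, l-1)\cdot \max(l+2,\, m+d+1).$$
   Context: All varieties are over an algebraically closed field $\mathbb{K}$ of characteristic zero, and $\mathbb{A}^n$ denotes affine $n$-space over $\mathbb{K}$. A morphism $f:\mathbb{A}^n\to\mathbb{A}^n\setminus Z$ is regarded as a polynomial map $f=(f_1,\ldots,f_n):\mathbb{A}^n\to\mathbb{A}^n$ whose image is contained in $\mathbb{A}^n\setminus Z$; it is surjective if its image equals $\mathbb{A}^n\setminus Z$. Its degree $\deg(f)$ is the maximum of the total degrees of the component polynomials $f_1,\ldots,f_n$. *)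

theory Defs
  imports
    "HOL-Library.Poly_Mapping"
    "HOL-Computational_Algebra.Polynomial"
    "Jordan_Normal_Form.Matrix"
begin

text \<open>
  A polynomial in the variables $x_0, x_1, \ldots$ maps each exponent vector
  (finitely supported on the variable indices) to its coefficient.
  Affine $n$-space over a field is \<open>carrier_vec n\<close>.
\<close>

type_synonym 'a mpoly = "(nat \<Rightarrow>\<^sub>0 nat) \<Rightarrow>\<^sub>0 'a"

definition mpolys_in :: "nat \<Rightarrow> 'a::zero mpoly set" where
  "mpolys_in n = {p. \<forall>e \<in> Poly_Mapping.keys p. Poly_Mapping.keys e \<subseteq> {..<n}}"

definition eval_mpoly :: "'a::comm_semiring_1 mpoly \<Rightarrow> 'a vec \<Rightarrow> 'a" where
  "eval_mpoly p x =
    (\<Sum>e \<in> Poly_Mapping.keys p. Poly_Mapping.lookup p e *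
      (\<Prod>i \<in> Poly_Mapping.keys e. (x $ i) ^ Poly_Mapping.lookup e i))"

text \<open>The zero polynomial gets total degree \<open>0\<close>.\<close>

definition total_degree :: "'a::zero mpoly \<Rightarrow> nat" where
  "total_degree p =
    Max (insert 0 ((\<lambda>e. \<Sum>i \<in> Poly_Mapping.keys e. Poly_Mapping.lookup e i) ` Poly_Mapping.keys p))"

definition zero_locus :: "nat \<Rightarrow> 'a::comm_semiring_1 mpoly set \<Rightarrow> 'a vec set" where
  "zero_locus n Q = {x \<in> carrier_vec n. \<forall>q \<in> Q. eval_mpoly q x = 0}"

text \<open>The product of subsets of affine spaces, under the identification of
  $\mathbb{A}^r \times \mathbb{A}^s$ with $\mathbb{A}^{r+s}$ by concatenating coordinates.\<close>

definition affine_prod :: "'a vec set \<Rightarrow> 'a vec set \<Rightarrow> 'a vec set" where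
  "affine_prod A B = {a @\<^sub>v b | a b. a \<in> A \<and> b \<in> B}"

definition eval_map :: "'a::comm_semiring_1 mpoly vec \<Rightarrow> 'a vec \<Rightarrow> 'a vec" where
  "eval_map f x = map_vec (\<lambda>p. eval_mpoly p x) f"

definition morphism_into :: "nat \<Rightarrow> 'a::comm_semiring_1 vec set \<Rightarrow> 'a mpoly vec \<Rightarrow> bool" where
  "morphism_into n U f \<longleftrightarrow>
    f \<in> carrier_vec n \<and> (\<forall>i<n. f $ i \<in> mpolys_in n) \<and> eval_map f ` carrier_vec n \<subseteq> U"

definition surjective_onto :: "nat \<Rightarrow> 'a::comm_semiring_1 vec set \<Rightarrow> 'a mpoly vec \<Rightarrow> bool" where
  "surjective_onto n U f \<longleftrightarrow> eval_map f ` carrier_vec n = U"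

text \<open>Only meaningful when \<open>dim_vec f > 0\<close>.\<close>

definition map_degree :: "'a::zero mpoly vec \<Rightarrow> nat" where
  "map_degree f = Max ((\<lambda>i. total_degree (f $ i)) ` {..<dim_vec f})"

end

theory Submission
  imports Defs
begin

text \<open>
  Write a point of the source as \<open>(x, y, z)\<close> with \<open>z\<close> in affine \<open>(n - 2)\<close>-space, and suppose
  that \<open>F\<close> lies on a line: its points are \<open>(a, 0)\<close> for the roots \<open>a\<close> of a polynomial \<open>P\<close> of
  degree \<open>l\<close>. The map \<open>(x, y, z) \<mapsto> (v, u, z)\<close> with
  \[ u = P(x)\,y - 1, \qquad v = x + u\,y + \sum_{j=1}^m q_j(z)\,y^{j+1} \]
  has the complement of \<open>F \<times> W\<close> as its image. For given \<open>(v, u, z)\<close> the second equation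
  says \<open>x = R(y)\<close> for the polynomial
  \[ R(y) = v - u\,y - \sum_{j=1}^m q_j(z)\,y^{j+1}, \]
  and the first becomes \<open>P(R(y)) y = u + 1\<close>. Over an algebraically closed field this has a solution
  \<open>y\<close> as soon as \<open>P \<circ> R\<close> is not the zero polynomial. Since the powers \<open>y, y^2, \<dots>, y^(m+1)\<close> are
  distinct, \<open>R\<close> is constant exactly when \<open>u\<close> and all \<open>q_j(z)\<close> vanish, and then its value is \<open>v\<close>;
  for a nonconstant \<open>R\<close> the composition cannot vanish, as \<open>P\<close> is not the zero polynomial.
  So only the points with \<open>u = 0\<close>, \<open>z \<in> W\<close> and \<open>P(v) = 0\<close> are missed; they are indeed missed,
  because there the equation reads \<open>0 = 1\<close>. This is
  \<open>basic_map_fibre_nonempty_iff\<close>. The components have degree at most \<open>max (l + 2) (m + d + 1)\<close>: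
  the term \<open>u y\<close> contributes \<open>l + 2\<close>, and the term with \<open>q_m\<close> contributes \<open>m + d + 1\<close>.

  A general \<open>F\<close> is moved to such a position by an automorphism of the plane
  (\<open>finite_plane_set_graph\<close>): a linear shear makes the first coordinates of the points of \<open>F\<close>
  distinct, and subtracting an interpolation polynomial of degree at most \<open>l - 1\<close> from the second
  coordinate then puts the points on a line. Composing the map above with the inverse automorphism
  multiplies the degree by at most \<open>max 1 (l - 1)\<close>.
\<close>

section \<open>Polynomial functions with a degree bound\<close>

text \<open>
  Degrees are bounded through the functions that polynomials induce: the closure properties below
  then need only the additive structure and the monomials of the formal polynomials.
\<close>

definition polynomial_fun :: "nat \<Rightarrow> nat \<Rightarrow> ('a::comm_ring_1 vec \<Rightarrow> 'a) \<Rightarrow> bool" where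
  "polynomial_fun n D g \<longleftrightarrow> (\<exists>p \<in> mpolys_in n. total_degree p \<le> D \<and>
     (\<forall>x \<in> carrier_vec n. eval_mpoly p x = g x))"

lemma total_degree_le_iff:
  assumes "p \<in> mpolys_in n"
  shows "total_degree p \<le> D \<longleftrightarrow>
    (\<forall>e \<in> Poly_Mapping.keys p. (\<Sum>i<n. Poly_Mapping.lookup e i) \<le> D)"
proof -
  have "(\<Sum>i \<in> Poly_Mapping.keys e. Poly_Mapping.lookup e i) = (\<Sum>i<n. Poly_Mapping.lookup e i)"
    if "e \<in> Poly_Mapping.keys p" for e
    using assms that by (intro sum.mono_neutral_left) (auto simp: mpolys_in_def in_keys_iff)
  then show ?thesis
    unfolding total_degree_def by (subst Max_le_iff) auto
qed

text \<open>
  Ranging over a fixed index set \<open>S\<close> of exponents and over all \<open>i < n\<close> makes evaluation additive in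
  the polynomial and turns sums of exponents into products of monomials.
\<close>

lemma eval_mpoly_superset:
  assumes "p \<in> mpolys_in n" "finite S" "Poly_Mapping.keys p \<subseteq> S"
  shows "eval_mpoly p x =
    (\<Sum>e\<in>S. Poly_Mapping.lookup p e * (\<Prod>i<n. (x $ i) ^ Poly_Mapping.lookup e i))"
proof -
  have "eval_mpoly p x = (\<Sum>e\<in>Poly_Mapping.keys p.
      Poly_Mapping.lookup p e * (\<Prod>i<n. (x $ i) ^ Poly_Mapping.lookup e i))"
    unfolding eval_mpoly_def
  proof (rule sum.cong[OF refl])
    fix e assume "e \<in> Poly_Mapping.keys p"
    then have "(\<Prod>i\<in>Poly_Mapping.keys e. (x $ i) ^ Poly_Mapping.lookup e i)
        = (\<Prod>i<n. (x $ i) ^ Poly_Mapping.lookup e i)"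
      using assms by (intro prod.mono_neutral_left) (auto simp: mpolys_in_def in_keys_iff)
    then show "Poly_Mapping.lookup p e * (\<Prod>i\<in>Poly_Mapping.keys e. (x $ i) ^ Poly_Mapping.lookup e i)
        = Poly_Mapping.lookup p e * (\<Prod>i<n. (x $ i) ^ Poly_Mapping.lookup e i)"
      by simp
  qed
  also have "\<dots> = (\<Sum>e\<in>S. Poly_Mapping.lookup p e * (\<Prod>i<n. (x $ i) ^ Poly_Mapping.lookup e i))"
    using assms(2,3) by (intro sum.mono_neutral_left) (auto simp: in_keys_iff)
  finally show ?thesis .
qed

lemma polynomial_fun_cong:
  assumes "polynomial_fun n D g" "\<And>x. x \<in> carrier_vec n \<Longrightarrow> g x = h x"
  shows "polynomial_fun n D h"
  using assms unfolding polynomial_fun_def by auto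

lemma polynomial_fun_mono: "polynomial_fun n D g \<Longrightarrow> D \<le> E \<Longrightarrow> polynomial_fun n E g"
  unfolding polynomial_fun_def by (meson le_trans)

lemma polynomial_fun_monomial:
  assumes "Poly_Mapping.keys e \<subseteq> {..<n}" "(\<Sum>i<n. Poly_Mapping.lookup e i) \<le> D"
  shows "polynomial_fun n D (\<lambda>x. c * (\<Prod>i<n. (x $ i) ^ Poly_Mapping.lookup e i))"
proof -
  have p: "Poly_Mapping.single e c \<in> mpolys_in n"
    using assms by (auto simp: mpolys_in_def split: if_splits)
  moreover have "total_degree (Poly_Mapping.single e c) \<le> D"
    unfolding total_degree_le_iff[OF p] using assms by (auto split: if_splits)
  moreover have "eval_mpoly (Poly_Mapping.single e c) x =
      c * (\<Prod>i<n. (x $ i) ^ Poly_Mapping.lookup e i)" for x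
    using eval_mpoly_superset[OF p, of "{e}" x] by (auto split: if_splits)
  ultimately show ?thesis unfolding polynomial_fun_def by blast
qed

lemma polynomial_fun_const: "polynomial_fun n D (\<lambda>x. c)"
  using polynomial_fun_monomial[of 0 n D c] by simp

lemma polynomial_fun_coordinate:
  assumes "i < n" "D \<ge> 1"
  shows "polynomial_fun n D (\<lambda>x::'a::comm_ring_1 vec. x $ i)"
proof -
  have exponent: "Poly_Mapping.lookup (Poly_Mapping.single i (1::nat)) k = (if k = i then 1 else 0)" for k
    by (simp add: lookup_single when_def)
  have "polynomial_fun n D (\<lambda>x::'a vec. 1 * (\<Prod>k<n. (x $ k) ^ Poly_Mapping.lookup (Poly_Mapping.single i 1) k))"
    using assms by (intro polynomial_fun_monomial) (auto simp: exponent simp del: One_nat_def)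
  moreover have "(\<Prod>k<n. (x $ k) ^ (if k = i then 1 else 0)) = x $ i" for x :: "'a vec"
  proof -
    have "(\<Prod>k<n. (x $ k) ^ (if k = i then 1 else 0)) = (\<Prod>k<n. if k = i then x $ k else 1)"
      by (intro prod.cong) auto
    then show ?thesis using assms by simp
  qed
  ultimately show ?thesis unfolding exponent by (simp only: mult_1)
qed

lemma polynomial_fun_add:
  assumes "polynomial_fun n D g" "polynomial_fun n D h"
  shows "polynomial_fun n D (\<lambda>x. g x + h x)"
proof -
  obtain p where p: "p \<in> mpolys_in n" "total_degree p \<le> D"
      "\<And>x. x \<in> carrier_vec n \<Longrightarrow> eval_mpoly p x = g x"
    using assms(1) unfolding polynomial_fun_def by blast
  obtain r where r: "r \<in> mpolys_in n" "total_degree r \<le> D"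
      "\<And>x. x \<in> carrier_vec n \<Longrightarrow> eval_mpoly r x = h x"
    using assms(2) unfolding polynomial_fun_def by blast
  let ?S = "Poly_Mapping.keys p \<union> Poly_Mapping.keys r"
  have keys: "Poly_Mapping.keys (p + r) \<subseteq> ?S"
    by (rule keys_add)
  have pr: "p + r \<in> mpolys_in n"
    using p(1) r(1) keys unfolding mpolys_in_def by blast
  moreover have "total_degree (p + r) \<le> D"
    using p(2) r(2) keys unfolding total_degree_le_iff[OF pr]
      total_degree_le_iff[OF p(1)] total_degree_le_iff[OF r(1)] by blast
  moreover have "eval_mpoly (p + r) x = g x + h x" if "x \<in> carrier_vec n" for x
  proof -
    have "eval_mpoly (p + r) x = eval_mpoly p x + eval_mpoly r x"
      using eval_mpoly_superset[OF pr, of ?S x] eval_mpoly_superset[OF p(1), of ?S x]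
        eval_mpoly_superset[OF r(1), of ?S x] keys
      by (simp add: lookup_add distrib_right sum.distrib)
    then show ?thesis using p(3) r(3) that by simp
  qed
  ultimately show ?thesis unfolding polynomial_fun_def by blast
qed

lemma polynomial_fun_sum:
  assumes "\<And>i. i \<in> I \<Longrightarrow> polynomial_fun n D (g i)"
  shows "polynomial_fun n D (\<lambda>x. \<Sum>i\<in>I. g i x)"
  using assms
  by (induction I rule: infinite_finite_induct)
    (auto intro: polynomial_fun_const polynomial_fun_add)

lemma polynomial_fun_mult:
  assumes "polynomial_fun n D g" "polynomial_fun n E h"
  shows "polynomial_fun n (D + E) (\<lambda>x. g x * h x)"
proof -
  obtain p where p: "p \<in> mpolys_in n" "total_degree p \<le> D"
      "\<And>x. x \<in> carrier_vec n \<Longrightarrow> eval_mpoly p x = g x"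
    using assms(1) unfolding polynomial_fun_def by blast
  obtain r where r: "r \<in> mpolys_in n" "total_degree r \<le> E"
      "\<And>x. x \<in> carrier_vec n \<Longrightarrow> eval_mpoly r x = h x"
    using assms(2) unfolding polynomial_fun_def by blast
  have "polynomial_fun n (D + E) (\<lambda>x. \<Sum>a\<in>Poly_Mapping.keys p. \<Sum>b\<in>Poly_Mapping.keys r.
     (Poly_Mapping.lookup p a * Poly_Mapping.lookup r b) *
       (\<Prod>i<n. (x $ i) ^ Poly_Mapping.lookup (a + b) i))"
  proof (intro polynomial_fun_sum polynomial_fun_monomial)
    fix a b assume ab: "a \<in> Poly_Mapping.keys p" "b \<in> Poly_Mapping.keys r"
    show "Poly_Mapping.keys (a + b) \<subseteq> {..<n}"
      using ab p(1) r(1) keys_add[of a b] unfolding mpolys_in_def by blast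
    show "(\<Sum>i<n. Poly_Mapping.lookup (a + b) i) \<le> D + E"
      using ab p(2) r(2) total_degree_le_iff[OF p(1), of D] total_degree_le_iff[OF r(1), of E]
      by (simp add: lookup_add sum.distrib add_mono)
  qed
  then show ?thesis
  proof (rule polynomial_fun_cong)
    fix x :: "'a vec" assume x: "x \<in> carrier_vec n"
    have "g x * h x = eval_mpoly p x * eval_mpoly r x"
      using p(3) r(3) x by simp
    also have "\<dots> = (\<Sum>a\<in>Poly_Mapping.keys p. \<Sum>b\<in>Poly_Mapping.keys r.
       (Poly_Mapping.lookup p a * Poly_Mapping.lookup r b) *
         (\<Prod>i<n. (x $ i) ^ Poly_Mapping.lookup (a + b) i))"
      by (simp add: eval_mpoly_superset[OF p(1) finite_keys order_refl]
          eval_mpoly_superset[OF r(1) finite_keys order_refl]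
          sum_product lookup_add power_add prod.distrib mult_ac)
    finally show "(\<Sum>a\<in>Poly_Mapping.keys p. \<Sum>b\<in>Poly_Mapping.keys r.
       (Poly_Mapping.lookup p a * Poly_Mapping.lookup r b) *
         (\<Prod>i<n. (x $ i) ^ Poly_Mapping.lookup (a + b) i)) = g x * h x" by simp
  qed
qed

lemma polynomial_fun_diff:
  assumes "polynomial_fun n D g" "polynomial_fun n D h"
  shows "polynomial_fun n D (\<lambda>x. g x - h x)"
proof -
  have "polynomial_fun n (0 + D) (\<lambda>x. - 1 * h x)"
    by (intro polynomial_fun_mult polynomial_fun_const assms)
  then have "polynomial_fun n D (\<lambda>x. - h x)" by simp
  from polynomial_fun_add[OF assms(1) this] show ?thesis by simp
qed

lemma polynomial_fun_power:
  assumes "polynomial_fun n D g"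
  shows "polynomial_fun n (k * D) (\<lambda>x. g x ^ k)"
  by (induction k) (use assms in \<open>auto intro: polynomial_fun_const polynomial_fun_mult\<close>)

lemma polynomial_fun_prod:
  assumes "\<And>i. i \<in> I \<Longrightarrow> polynomial_fun n (D i) (g i)"
  shows "polynomial_fun n (\<Sum>i\<in>I. D i) (\<lambda>x. \<Prod>i\<in>I. g i x)"
  using assms
  by (induction I rule: infinite_finite_induct)
    (auto intro: polynomial_fun_const polynomial_fun_mult)

lemma polynomial_fun_poly:
  assumes "polynomial_fun n D g" "degree P \<le> k"
  shows "polynomial_fun n (k * D) (\<lambda>x. poly P (g x))"
  unfolding poly_altdef
proof (intro polynomial_fun_sum)
  fix i assume "i \<in> {..degree P}"
  then have "i * D \<le> k * D" using assms(2) by simp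
  moreover have "polynomial_fun n (0 + i * D) (\<lambda>x. coeff P i * g x ^ i)"
    by (intro polynomial_fun_mult polynomial_fun_const polynomial_fun_power assms)
  ultimately show "polynomial_fun n (k * D) (\<lambda>x. coeff P i * g x ^ i)"
    by (metis add_0 polynomial_fun_mono)
qed

text \<open>
  Reading the variable \<open>i\<close> as the coordinate \<open>n - k + i\<close> does not change any degree.
\<close>

lemma polynomial_fun_vec_last:
  assumes "r \<in> mpolys_in k" "total_degree r \<le> D" "k \<le> n"
  shows "polynomial_fun n D (\<lambda>x. eval_mpoly r (vec_last x k))"
proof -
  have "polynomial_fun n D (\<lambda>x. \<Sum>e\<in>Poly_Mapping.keys r. Poly_Mapping.lookup r e *
      (\<Prod>i<k. (x $ (n - k + i)) ^ Poly_Mapping.lookup e i))"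
  proof (intro polynomial_fun_sum)
    fix e assume "e \<in> Poly_Mapping.keys r"
    then have deg: "0 + (\<Sum>i<k. Poly_Mapping.lookup e i * 1) \<le> D"
      using assms(2) total_degree_le_iff[OF assms(1), of D] by simp
    have "polynomial_fun n (0 + (\<Sum>i<k. Poly_Mapping.lookup e i * 1)) (\<lambda>x. Poly_Mapping.lookup r e *
        (\<Prod>i<k. (x $ (n - k + i)) ^ Poly_Mapping.lookup e i))"
      by (intro polynomial_fun_mult polynomial_fun_const polynomial_fun_prod
          polynomial_fun_power polynomial_fun_coordinate) (use assms(3) in auto)
    then show "polynomial_fun n D (\<lambda>x. Poly_Mapping.lookup r e *
        (\<Prod>i<k. (x $ (n - k + i)) ^ Poly_Mapping.lookup e i))"
      using deg by (rule polynomial_fun_mono)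
  qed
  then show ?thesis
    by (rule polynomial_fun_cong)
      (simp add: eval_mpoly_superset[OF assms(1) finite_keys order_refl] vec_last_def)
qed

lemma polynomial_map_exists:
  assumes "n > 0" "\<And>i. i < n \<Longrightarrow> polynomial_fun n D (\<lambda>x. G x $ i)"
    and "\<And>x. x \<in> carrier_vec n \<Longrightarrow> G x \<in> carrier_vec n"
  obtains f where "f \<in> carrier_vec n" "\<And>i. i < n \<Longrightarrow> f $ i \<in> mpolys_in n"
    "map_degree f \<le> D" "\<And>x. x \<in> carrier_vec n \<Longrightarrow> eval_map f x = G x"
proof -
  obtain p where p: "\<And>i. i < n \<Longrightarrow> p i \<in> mpolys_in n \<and> total_degree (p i) \<le> D \<and>
      (\<forall>x \<in> carrier_vec n. eval_mpoly (p i) x = G x $ i)"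
    using assms(2) unfolding polynomial_fun_def Bex_def by metis
  show thesis
  proof (rule that[of "vec n p"])
    show "map_degree (vec n p) \<le> D"
      unfolding map_degree_def using p assms(1) by (subst Max_le_iff) auto
    show "eval_map (vec n p) x = G x" if "x \<in> carrier_vec n" for x
      using p assms(3)[OF that] that by (intro eq_vecI) (auto simp: eval_map_def)
  qed (use p in auto)
qed

section \<open>Finite sets of points in the plane\<close>

lemma interpolation_poly_exists:
  fixes h :: "'a::field \<Rightarrow> 'a"
  assumes "finite A"
  shows "\<exists>p. degree p \<le> card A - 1 \<and> (\<forall>a\<in>A. poly p a = h a)"
  using assms
proof (induction A rule: finite_induct)
  case empty
  show ?case by (intro exI[of _ 0]) simp
next
  case (insert b A)
  then obtain p where p: "degree p \<le> card A - 1" "\<forall>a\<in>A. poly p a = h a" by blast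
  define N where "N = (\<Prod>a\<in>A. [:- a, 1:])"
  have N: "poly N b \<noteq> 0" "\<forall>a\<in>A. poly N a = 0"
    using insert.hyps by (auto simp: N_def poly_prod)
  have "degree N \<le> card A"
    using degree_prod_sum_le[of A "\<lambda>a. [:- a, 1:]"] insert.hyps by (simp add: N_def)
  then have "degree (p + Polynomial.smult ((h b - poly p b) / poly N b) N) \<le> card A"
    using p(1) by (intro degree_add_le) auto
  then show ?case
    using p(2) N insert.hyps
    by (intro exI[of _ "p + Polynomial.smult ((h b - poly p b) / poly N b) N"]) auto
qed

text \<open>
  Two points that differ in the second coordinate collide for exactly one value of \<open>c\<close>,
  other distinct points for none, so finitely many values have to be avoided in an infinite field.
\<close>

lemma injective_shear_exists:
  fixes F :: "'a::field_char_0 vec set"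
  assumes "finite F" "F \<subseteq> carrier_vec 2"
  shows "\<exists>c. inj_on (\<lambda>w. w $ 0 + c * w $ 1) F"
proof -
  define B where "B = (\<lambda>(v, w). (v $ 0 - w $ 0) / (w $ 1 - v $ 1)) ` (F \<times> F)"
  have "finite B" unfolding B_def using assms(1) by simp
  then obtain c where c: "c \<notin> B"
    using ex_new_if_finite infinite_UNIV_char_0 by blast
  have "v = w" if vw: "v \<in> F" "w \<in> F" and eq: "v $ 0 + c * v $ 1 = w $ 0 + c * w $ 1" for v w
  proof -
    have "v $ 1 = w $ 1"
    proof (rule ccontr)
      assume "v $ 1 \<noteq> w $ 1"
      then have "c = (v $ 0 - w $ 0) / (w $ 1 - v $ 1)"
        using eq by (simp add: field_simps)
      then have "c \<in> B" using vw by (auto simp: B_def)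
      then show False using c by simp
    qed
    with eq have "v $ 0 = w $ 0" by simp
    moreover have "v \<in> carrier_vec 2" "w \<in> carrier_vec 2" using vw assms(2) by auto
    ultimately show ?thesis
      using \<open>v $ 1 = w $ 1\<close> by (intro eq_vecI) (auto simp: less_2_cases_iff)
  qed
  then show ?thesis by (auto intro!: exI[of _ c] inj_onI)
qed

text \<open>
  In the sheared coordinates \<open>(s, t)\<close> with \<open>s = w $ 0 + c * w $ 1\<close>, the set \<open>F\<close> is the part of the
  graph of an interpolation polynomial \<open>p\<close> that lies over the roots of \<open>P\<close>. Hence \<open>(s, t - p(s))\<close>
  are coordinates in which \<open>F\<close> lies on a line.
\<close>

lemma finite_plane_set_graph:
  fixes F :: "'a::field_char_0 vec set"
  assumes "finite F" "F \<subseteq> carrier_vec 2"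
  obtains P p c where "P \<noteq> 0" "degree P \<le> card F" "degree p \<le> card F - 1"
    "\<And>w. w \<in> carrier_vec 2 \<Longrightarrow> w \<in> F \<longleftrightarrow>
       w $ 1 = poly p (w $ 0 + c * w $ 1) \<and> poly P (w $ 0 + c * w $ 1) = 0"
proof -
  obtain c where inj: "inj_on (\<lambda>w. w $ 0 + c * w $ 1) F"
    using injective_shear_exists[OF assms] by blast
  define \<sigma> where "\<sigma> w = w $ 0 + c * w $ 1" for w :: "'a vec"
  have inj: "inj_on \<sigma> F" using inj by (simp add: \<sigma>_def[abs_def])
  have card: "card (\<sigma> ` F) = card F" by (rule card_image[OF inj])
  obtain p where p: "degree p \<le> card (\<sigma> ` F) - 1"
      "\<forall>a\<in>\<sigma> ` F. poly p a = the_inv_into F \<sigma> a $ 1"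
    using interpolation_poly_exists[of "\<sigma> ` F" "\<lambda>a. the_inv_into F \<sigma> a $ 1"] assms(1) by auto
  define P where "P = (\<Prod>a\<in>\<sigma> ` F. [:- a, 1:])"
  have root: "poly P s = 0 \<longleftrightarrow> s \<in> \<sigma> ` F" for s
    using assms(1) by (auto simp: P_def poly_prod)
  show thesis
  proof (rule that[of P p c])
    show "P \<noteq> 0" using assms(1) by (auto simp: P_def)
    show "degree P \<le> card F"
      using degree_prod_sum_le[of "\<sigma> ` F" "\<lambda>a. [:- a, 1:]"] assms(1) card by (simp add: P_def)
    show "degree p \<le> card F - 1" using p(1) card by simp
    show "w \<in> F \<longleftrightarrow> w $ 1 = poly p (w $ 0 + c * w $ 1) \<and> poly P (w $ 0 + c * w $ 1) = 0"
      if w: "w \<in> carrier_vec 2" for w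
    proof
      assume "w \<in> F"
      then show "w $ 1 = poly p (w $ 0 + c * w $ 1) \<and> poly P (w $ 0 + c * w $ 1) = 0"
        using p(2) root inj unfolding \<sigma>_def[symmetric] by (auto simp: the_inv_into_f_f)
    next
      assume *: "w $ 1 = poly p (w $ 0 + c * w $ 1) \<and> poly P (w $ 0 + c * w $ 1) = 0"
      then obtain v where v: "v \<in> F" "\<sigma> w = \<sigma> v"
        using root unfolding \<sigma>_def[symmetric] by blast
      then have "w $ 1 = v $ 1"
        using * p(2) inj unfolding \<sigma>_def[symmetric] by (auto simp: the_inv_into_f_f)
      moreover from this v have "w $ 0 = v $ 0" by (simp add: \<sigma>_def)
      moreover have "v \<in> carrier_vec 2" using v assms(2) by auto
      ultimately have "w = v"
        using w by (intro eq_vecI) (auto simp: less_2_cases_iff)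
      with v show "w \<in> F" by simp
    qed
  qed
qed

section \<open>The fibres of the basic map\<close>

text \<open>
  The factor \<open>y\<close> makes \<open>Q(y) y - w\<close> nonconstant even when \<open>Q\<close> is a nonzero constant.
\<close>

lemma poly_mult_id_surj:
  fixes Q :: "'a::alg_closed_field poly"
  assumes "Q \<noteq> 0"
  shows "\<exists>y. poly Q y * y = w"
proof -
  have "degree (pCons (- w) Q) > 0" using assms by simp
  then obtain y where "poly (pCons (- w) Q) y = 0"
    using alg_closed_imp_poly_has_root by blast
  then show ?thesis by (intro exI[of _ y]) (simp add: algebra_simps)
qed

text \<open>
  The second equation determines \<open>x\<close> as a polynomial \<open>R\<close> in \<open>y\<close>, which leaves one equation
  \<open>P(R(y)) y = u + 1\<close>. The exponents start at \<open>j + 1 = 2\<close> so that the terms \<open>b j * y ^ (j + 1)\<close>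
  cannot cancel the linear term \<open>u * y\<close>, nor each other: \<open>R\<close> is constant only if all of
  these coefficients vanish.
\<close>

lemma basic_map_fibre_nonempty_iff:
  fixes P :: "'a::alg_closed_field poly" and b :: "nat \<Rightarrow> 'a"
  assumes "P \<noteq> 0"
  shows "(\<exists>x y. poly P x * y - 1 = u \<and> x + u * y + (\<Sum>j=1..m. b j * y ^ (j + 1)) = v) \<longleftrightarrow>
    \<not> (u = 0 \<and> poly P v = 0 \<and> (\<forall>j\<in>{1..m}. b j = 0))"
    (is "?L \<longleftrightarrow> ?R")
proof
  assume ?L
  then obtain x y where xy: "poly P x * y - 1 = u" "x + u * y + (\<Sum>j=1..m. b j * y ^ (j + 1)) = v"
    by blast
  show ?R
  proof
    assume z: "u = 0 \<and> poly P v = 0 \<and> (\<forall>j\<in>{1..m}. b j = 0)"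
    then have "x = v" using xy(2) by simp
    then show False using xy(1) z by simp
  qed
next
  assume R: ?R
  define R where "R = [:v, - u:] - (\<Sum>j=1..m. monom (b j) (j + 1))"
  have eval: "poly R y = v - u * y - (\<Sum>j=1..m. b j * y ^ (j + 1))" for y
    by (simp add: R_def poly_sum poly_monom algebra_simps)
  have "pcompose P R \<noteq> 0"
  proof
    assume zero: "pcompose P R = 0"
    then have "degree R = 0" using assms pcompose_eq_0 by blast
    then have coeff0: "coeff R k = 0" if "k > 0" for k
      using that by (simp add: coeff_eq_0)
    have coeff_sum: "coeff (\<Sum>j=1..m. monom (b j) (j + 1)) k = (\<Sum>j=1..m. if j + 1 = k then b j else 0)" for k
      by (simp add: coeff_sum coeff_monom)
    have "coeff R 1 = - u"
      unfolding R_def coeff_diff coeff_sum by (auto intro!: sum.neutral)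
    then have u: "u = 0" using coeff0[of 1] by simp
    have b: "b j = 0" if "j \<in> {1..m}" for j
    proof -
      have "coeff R (j + 1) = - b j"
        unfolding R_def coeff_diff coeff_sum using that u by simp
      then show ?thesis using coeff0[of "j + 1"] by simp
    qed
    then have "poly R 0 = v" using u by (simp add: eval)
    then have "poly P v = 0"
      using zero poly_pcompose[of P R 0] by simp
    then show False using R u b by blast
  qed
  then obtain y where "poly (pcompose P R) y * y = u + 1"
    using poly_mult_id_surj by blast
  then have "poly P (poly R y) * y - 1 = u" by (simp add: poly_pcompose)
  moreover have "poly R y + u * y + (\<Sum>j=1..m. b j * y ^ (j + 1)) = v" by (simp add: eval)
  ultimately show ?L by blast
qed

section \<open>The surjective morphism\<close>

lemma affine_prod_iff:
  assumes "A \<subseteq> carrier_vec k" "B \<subseteq> carrier_vec r" "w \<in> carrier_vec (k + r)"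
  shows "w \<in> affine_prod A B \<longleftrightarrow> vec_first w k \<in> A \<and> vec_last w r \<in> B"
proof
  assume "w \<in> affine_prod A B"
  then obtain a b where ab: "w = a @\<^sub>v b" "a \<in> A" "b \<in> B"
    unfolding affine_prod_def by blast
  then have "a \<in> carrier_vec k" "b \<in> carrier_vec r" using assms(1,2) by auto
  then have "vec_first w k = a" "vec_last w r = b"
    unfolding ab(1) by (auto simp: vec_first_def vec_last_def)
  then show "vec_first w k \<in> A \<and> vec_last w r \<in> B" using ab by simp
next
  assume "vec_first w k \<in> A \<and> vec_last w r \<in> B"
  moreover have "w = vec_first w k @\<^sub>v vec_last w r" using assms(3) by simp
  ultimately show "w \<in> affine_prod A B" unfolding affine_prod_def by blast
qed

theorem theorem1p2:
  fixes n l m d :: nat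
    and F W Z :: "'a::{alg_closed_field, field_char_0} vec set"
    and q :: "nat \<Rightarrow> 'a mpoly"
  assumes "n \<ge> 2"
    and "F \<subseteq> carrier_vec 2" and "finite F" and "card F = l"
    and "\<And>j. j \<in> {1..m} \<Longrightarrow> q j \<in> mpolys_in (n - 2) \<and> total_degree (q j) \<le> d"
    and "W = zero_locus (n - 2) (q ` {1..m})"
    and "Z = affine_prod F W"
  shows "\<exists>f. morphism_into n (carrier_vec n - Z) f \<and> surjective_onto n (carrier_vec n - Z) f \<and>
             map_degree f \<le> max 1 (l - 1) * max (l + 2) (m + d + 1)"
proof -
  obtain P p c where P: "P \<noteq> 0" "degree P \<le> l" and p: "degree p \<le> l - 1"
    and F_iff: "\<And>w. w \<in> carrier_vec 2 \<Longrightarrow> w \<in> F \<longleftrightarrow>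
       w $ 1 = poly p (w $ 0 + c * w $ 1) \<and> poly P (w $ 0 + c * w $ 1) = 0"
    using finite_plane_set_graph[OF assms(3,2)] assms(4) by metis
  define D where "D = max (l + 2) (m + d + 1)"
  \<comment> \<open>\<open>V\<close> and \<open>U\<close> are the basic map; \<open>G\<close> follows it by the inverse of the plane automorphism
    \<open>(a, b) \<mapsto> (a + c b, b - p(a + c b))\<close>, which takes \<open>F\<close> into a line.\<close>
  define U where "U x = poly P (x $ 0) * x $ 1 - 1" for x :: "'a vec"
  define V where "V x = x $ 0 + U x * x $ 1 +
      (\<Sum>j=1..m. eval_mpoly (q j) (vec_last x (n - 2)) * (x $ 1) ^ (j + 1))" for x :: "'a vec"
  define T where "T x = U x + poly p (V x)" for x
  define G where "G x = vec n (\<lambda>i. if i = 0 then V x - c * T x else if i = 1 then T x else x $ i)"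
    for x :: "'a vec"
  have x0: "polynomial_fun n k (\<lambda>x::'a vec. x $ 0)" and x1: "polynomial_fun n k (\<lambda>x::'a vec. x $ 1)"
    if "k \<ge> 1" for k
    using that assms(1) by (auto intro: polynomial_fun_coordinate)
  have U: "polynomial_fun n (l + 1) U"
  proof -
    have "polynomial_fun n (l * 1 + 1) (\<lambda>x. poly P (x $ 0) * x $ 1 - 1)"
      by (intro polynomial_fun_diff polynomial_fun_mult polynomial_fun_poly
          polynomial_fun_const x0 x1 P) auto
    then show ?thesis by (simp add: U_def[abs_def])
  qed
  have V: "polynomial_fun n D V"
    unfolding V_def[abs_def]
  proof (intro polynomial_fun_add polynomial_fun_sum)
    show "polynomial_fun n D (\<lambda>x::'a vec. x $ 0)" by (rule x0) (simp add: D_def)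
    show "polynomial_fun n D (\<lambda>x. U x * x $ 1)"
      by (rule polynomial_fun_mono[OF polynomial_fun_mult[OF U x1[OF order_refl]]])
        (simp add: D_def)
    fix j assume j: "j \<in> {1..m}"
    have "polynomial_fun n (d + (j + 1) * 1)
        (\<lambda>x. eval_mpoly (q j) (vec_last x (n - 2)) * (x $ 1) ^ (j + 1))"
      using assms(5)[OF j]
      by (intro polynomial_fun_mult polynomial_fun_power polynomial_fun_vec_last x1) auto
    then show "polynomial_fun n D
        (\<lambda>x. eval_mpoly (q j) (vec_last x (n - 2)) * (x $ 1) ^ (j + 1))"
      by (rule polynomial_fun_mono) (use j in \<open>auto simp: D_def\<close>)
  qed
  let ?E = "max 1 (l - 1) * D"
  have DE: "D \<le> ?E" by simp
  have T: "polynomial_fun n ?E T"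
    unfolding T_def[abs_def]
  proof (rule polynomial_fun_add)
    have "l + 1 \<le> ?E" using DE unfolding D_def by linarith
    with U show "polynomial_fun n ?E U" by (rule polynomial_fun_mono)
    show "polynomial_fun n ?E (\<lambda>x. poly p (V x))"
      using p by (intro polynomial_fun_poly V) simp
  qed
  have G_poly: "polynomial_fun n ?E (\<lambda>x. G x $ i)" if i: "i < n" for i
  proof -
    have "polynomial_fun n ?E (\<lambda>x. V x - c * T x)"
    proof (rule polynomial_fun_diff)
      show "polynomial_fun n ?E V" using V DE by (rule polynomial_fun_mono)
      show "polynomial_fun n ?E (\<lambda>x. c * T x)"
        using polynomial_fun_mult[OF polynomial_fun_const[of n 0 c] T] by simp
    qed
    moreover have "polynomial_fun n ?E (\<lambda>x. x $ i)"
    proof (rule polynomial_fun_coordinate[OF i])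
      show "1 \<le> ?E" using DE unfolding D_def by linarith
    qed
    ultimately show ?thesis using T i by (cases "i = 0"; cases "i = 1") (simp_all add: G_def)
  qed
  have image: "G ` carrier_vec n = carrier_vec n - Z"
  proof -
    have "(\<exists>x\<in>carrier_vec n. G x = w) \<longleftrightarrow> w \<notin> Z" if w: "w \<in> carrier_vec n" for w
    proof -
      \<comment> \<open>\<open>(v, u)\<close> is the image of the first two coordinates of \<open>w\<close> under the plane automorphism.\<close>
      define z where "z = vec_last w (n - 2)"
      define v where "v = w $ 0 + c * w $ 1"
      define u where "u = w $ 1 - poly p v"
      have "(\<exists>x\<in>carrier_vec n. G x = w) \<longleftrightarrow>
          (\<exists>x\<in>carrier_vec n. U x = u \<and> V x = v \<and> vec_last x (n - 2) = z)"
      proof (rule bex_cong[OF refl])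
        fix x :: "'a vec" assume x: "x \<in> carrier_vec n"
        have "G x = w \<longleftrightarrow> (\<forall>i<n. G x $ i = w $ i)"
          using w by (auto simp: G_def vec_eq_iff)
        also have "\<dots> \<longleftrightarrow> G x $ 0 = w $ 0 \<and> G x $ 1 = w $ 1 \<and> (\<forall>i<n-2. G x $ (2+i) = w $ (2+i))"
        proof -
          have "i = 0 \<or> i = 1 \<or> (\<exists>k<n-2. i = 2 + k)" if "i < n" for i
            using that by presburger
          then show ?thesis using assms(1) by fastforce
        qed
        also have "\<dots> \<longleftrightarrow> V x - c * T x = w $ 0 \<and> T x = w $ 1 \<and> vec_last x (n - 2) = z"
          using assms(1) w x by (simp add: G_def z_def vec_last_def vec_eq_iff)
        also have "\<dots> \<longleftrightarrow> U x = u \<and> V x = v \<and> vec_last x (n - 2) = z"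
        proof -
          have "V x - c * T x = w $ 0 \<and> T x = w $ 1 \<longleftrightarrow> V x = v \<and> T x = w $ 1"
            by (auto simp: v_def algebra_simps)
          also have "\<dots> \<longleftrightarrow> U x = u \<and> V x = v"
            unfolding T_def u_def eq_diff_eq by auto
          finally show ?thesis by blast
        qed
        finally show "G x = w \<longleftrightarrow> U x = u \<and> V x = v \<and> vec_last x (n - 2) = z" .
      qed
      also have "\<dots> \<longleftrightarrow> (\<exists>a b. poly P a * b - 1 = u \<and>
          a + u * b + (\<Sum>j=1..m. eval_mpoly (q j) z * b ^ (j + 1)) = v)" (is "?L \<longleftrightarrow> ?R")
      proof
        assume ?L
        then obtain x where "U x = u" "V x = v" "vec_last x (n - 2) = z" by blast
        then show ?R
          by (intro exI[of _ "x $ 0"] exI[of _ "x $ 1"]) (auto simp: U_def V_def)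
      next
        assume ?R
        then obtain a b where ab: "poly P a * b - 1 = u"
            "a + u * b + (\<Sum>j=1..m. eval_mpoly (q j) z * b ^ (j + 1)) = v" by blast
        define x where "x = vec n (\<lambda>i. if i = 0 then a else if i = 1 then b else w $ i)"
        have "x \<in> carrier_vec n" "x $ 0 = a" "x $ 1 = b" "vec_last x (n - 2) = z"
          using assms(1) w by (auto simp: x_def z_def vec_last_def)
        then show ?L using ab by (intro bexI[of _ x]) (auto simp: U_def V_def)
      qed
      also have "\<dots> \<longleftrightarrow> \<not> (u = 0 \<and> poly P v = 0 \<and> (\<forall>j\<in>{1..m}. eval_mpoly (q j) z = 0))"
        by (rule basic_map_fibre_nonempty_iff[OF P(1)])
      also have "\<dots> \<longleftrightarrow> \<not> (vec_first w 2 \<in> F \<and> z \<in> W)"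
        using F_iff[of "vec_first w 2"] assms(1) w
        by (auto simp: assms(6) zero_locus_def u_def v_def z_def vec_first_def)
      also have "\<dots> \<longleftrightarrow> w \<notin> Z"
      proof -
        have "W \<subseteq> carrier_vec (n - 2)" by (auto simp: assms(6) zero_locus_def)
        moreover have "w \<in> carrier_vec (2 + (n - 2))"
          using w assms(1) by (simp only: le_add_diff_inverse)
        ultimately show ?thesis
          unfolding z_def assms(7) by (simp only: affine_prod_iff[OF assms(2)])
      qed
      finally show ?thesis .
    qed
    moreover have "G x \<in> carrier_vec n" for x by (simp add: G_def)
    ultimately show ?thesis by blast
  qed
  obtain f where f: "f \<in> carrier_vec n" "\<And>i. i < n \<Longrightarrow> f $ i \<in> mpolys_in n"
    "map_degree f \<le> ?E" "\<And>x. x \<in> carrier_vec n \<Longrightarrow> eval_map f x = G x"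
    using polynomial_map_exists[of n ?E G] assms(1) G_poly by (auto simp: G_def)
  have "eval_map f ` carrier_vec n = carrier_vec n - Z"
    using f(4) image by auto
  then show ?thesis
    using f(1-3) unfolding morphism_into_def surjective_onto_def D_def by blast
qed

end
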